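(* Let $H$ be a complex Hilbert space, let $\mathcal{F}\subseteq B(H)$ be a family of partial isometries which is totally ordered in the Halmos--McLaughlin ordering, and let $$\mathcal{A}_{\mathcal{F}}=\{T\in B(H)\colon (I-Q_E)TP_E=0 \text{ for all } E\in\mathcal{F}\}.$$ Let $\mathcal{N}_Q=\{Q_E\colon E\in\mathcal{F}\}\cup\{0,I\}$. The following are equivalent. (i) $\mathcal{A}_{\mathcal{F}}$ is an algebra. (ii) $\mathcal{A}_{\mathcal{F}}$ is a left ideal of the nest algebra $\operatorname{alg}\mathcal{N}_Q$. (iii) For all $E\in\mathcal{F}$, $\operatorname{ran}(E)\subseteq\ker(E)^{\perp}$ or $\operatorname{ran}(E)=H$.
   Context: $B(H)$ is the set of bounded linear operators on $H$ and $I$ is the identity operator. A partial isometry is $V\in B(H)$ with $\|Vx\|=\|x\|$ for all $x\in\ker(V)^\perp$; its initial space is $\ker(V)^\perp$ and its final space is $\operatorname{ran}(V)$. For a partial isometry $V$, $P_V=V^*V$ is the orthogonal projection onto the initial space and $Q_V=VV^*$ is the orthogonal projection onto the final space. Halmos--McLaughlin ordering: $E\le F$ if $F(x)=E(x)$ for all $x$ in the initial space of $E$ (in particular the initial space of $E$ is contained in that of $F$, because $E$ is isometric on it and, in this ordering, initial spaces are nested). "Algebra" means subalgebra of $B(H)$ (closed under products). A nest is a totally ordered family $\mathcal{N}$ of self-adjoint projections in $B(H)$ containing $0$ and $I$; the nest algebra $\operatorname{alg}\mathcal{N}$ is the set of $T\in B(H)$ leaving invariant the range of every projection in $\mathcal{N}$.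 When $\mathcal{F}$ is totally ordered, $\mathcal{N}_Q$ is a nest. *)

theory Defs
  imports "HOL-Analysis.Analysis"
begin

text \<open>
  The real inner product, the norm and the topology come from the underlying real Hilbert space;
  \<open>re_cinner\<close> says that they are the ones induced by the complex inner product, which is linear
  in its first argument. Positive definiteness is inherited through \<open>re_cinner\<close>.
\<close>

class complex_hilbert_space = real_inner + complete_space +
  fixes scaleC :: "complex \<Rightarrow> 'a \<Rightarrow> 'a"  (infixr \<open>*\<^sub>C\<close> 75)
    and cinner :: "'a \<Rightarrow> 'a \<Rightarrow> complex"
  assumes scaleC_of_real: "complex_of_real r *\<^sub>C x = r *\<^sub>R x"
    and scaleC_add_right: "c *\<^sub>C (x + y) = c *\<^sub>C x + c *\<^sub>C y"
    and scaleC_add_left: "(c + d) *\<^sub>C x = c *\<^sub>C x + d *\<^sub>C x"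
    and scaleC_scaleC: "c *\<^sub>C d *\<^sub>C x = (c * d) *\<^sub>C x"
    and cinner_commute: "cinner x y = cnj (cinner y x)"
    and cinner_add_left: "cinner (x + y) z = cinner x z + cinner y z"
    and cinner_scaleC_left: "cinner (c *\<^sub>C x) y = c * cinner x y"
    and re_cinner: "Re (cinner x y) = inner x y"

instantiation complex :: complex_hilbert_space
begin

definition "scaleC_complex (c::complex) (x::complex) = c * x"
definition "cinner_complex (x::complex) (y::complex) = x * cnj y"

instance
  by standard
    (simp_all add: scaleC_complex_def cinner_complex_def algebra_simps scaleR_conv_of_real
      inner_complex_def)

end

definition bounded_ops :: "('a::complex_hilbert_space \<Rightarrow> 'a) set" where
  "bounded_ops = {T. bounded_linear T \<and> (\<forall>c x. T (c *\<^sub>C x) = c *\<^sub>C T x)}"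

definition kernel :: "('a::complex_hilbert_space \<Rightarrow> 'a) \<Rightarrow> 'a set" where
  "kernel T = {x. T x = 0}"

definition orth_compl :: "'a::complex_hilbert_space set \<Rightarrow> 'a set" where
  "orth_compl S = {x. \<forall>y\<in>S. cinner x y = 0}"

definition adj :: "('a::complex_hilbert_space \<Rightarrow> 'a) \<Rightarrow> 'a \<Rightarrow> 'a" where
  "adj T = (THE S. S \<in> bounded_ops \<and> (\<forall>x y. cinner (T x) y = cinner x (S y)))"

definition initial_space :: "('a::complex_hilbert_space \<Rightarrow> 'a) \<Rightarrow> 'a set" where
  "initial_space V = orth_compl (kernel V)"

definition partial_isometry :: "('a::complex_hilbert_space \<Rightarrow> 'a) \<Rightarrow> bool" where
  "partial_isometry V \<longleftrightarrow> V \<in> bounded_ops \<and> (\<forall>x\<in>initial_space V. norm (V x) = norm x)"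

definition init_proj :: "('a::complex_hilbert_space \<Rightarrow> 'a) \<Rightarrow> 'a \<Rightarrow> 'a" where
  "init_proj V = adj V \<circ> V"

definition final_proj :: "('a::complex_hilbert_space \<Rightarrow> 'a) \<Rightarrow> 'a \<Rightarrow> 'a" where
  "final_proj V = V \<circ> adj V"

text \<open>Halmos--McLaughlin ordering; for partial isometries the inclusion of the initial spaces
  is a consequence.\<close>

definition hm_le :: "('a::complex_hilbert_space \<Rightarrow> 'a) \<Rightarrow> ('a \<Rightarrow> 'a) \<Rightarrow> bool" where
  "hm_le E F \<longleftrightarrow> (\<forall>x\<in>initial_space E. F x = E x)"

definition op_subspace :: "('a::complex_hilbert_space \<Rightarrow> 'a) set \<Rightarrow> bool" where
  "op_subspace \<A> \<longleftrightarrow> \<A> \<subseteq> bounded_ops \<and> (\<lambda>x. 0) \<in> \<A> \<and>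
     (\<forall>S\<in>\<A>. \<forall>T\<in>\<A>. (\<lambda>x. S x + T x) \<in> \<A>) \<and>
     (\<forall>c. \<forall>T\<in>\<A>. (\<lambda>x. c *\<^sub>C T x) \<in> \<A>)"

text \<open>Subalgebras need not contain the identity.\<close>

definition op_algebra :: "('a::complex_hilbert_space \<Rightarrow> 'a) set \<Rightarrow> bool" where
  "op_algebra \<A> \<longleftrightarrow> op_subspace \<A> \<and> (\<forall>S\<in>\<A>. \<forall>T\<in>\<A>. S \<circ> T \<in> \<A>)"

definition left_ideal_of ::
  "('a::complex_hilbert_space \<Rightarrow> 'a) set \<Rightarrow> ('a \<Rightarrow> 'a) set \<Rightarrow> bool" where
  "left_ideal_of \<J> \<A> \<longleftrightarrow> \<J> \<subseteq> \<A> \<and> op_subspace \<J> \<and> (\<forall>S\<in>\<A>. \<forall>T\<in>\<J>. S \<circ> T \<in> \<J>)"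

definition nest_algebra ::
  "('a::complex_hilbert_space \<Rightarrow> 'a) set \<Rightarrow> ('a \<Rightarrow> 'a) set" where
  "nest_algebra \<N> = {T \<in> bounded_ops. \<forall>P\<in>\<N>. T ` range P \<subseteq> range P}"

definition final_nest ::
  "('a::complex_hilbert_space \<Rightarrow> 'a) set \<Rightarrow> ('a \<Rightarrow> 'a) set" where
  "final_nest \<F> = final_proj ` \<F> \<union> {\<lambda>x. 0, id}"

text \<open>The condition reads \<open>(I - Q\<^sub>E) T P\<^sub>E = 0\<close>, pointwise.\<close>

definition fam_ops ::
  "('a::complex_hilbert_space \<Rightarrow> 'a) set \<Rightarrow> ('a \<Rightarrow> 'a) set" where
  "fam_ops \<F> = {T \<in> bounded_ops. \<forall>E\<in>\<F>. \<forall>x.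
     T (init_proj E x) - final_proj E (T (init_proj E x)) = 0}"

end

theory Submission
  imports Defs
begin

text \<open>
  Write \<open>I\<^sub>E\<close> for the initial space of \<open>E\<close>. Since \<open>E\<^sup>*E\<close> projects onto \<open>I\<^sub>E\<close> and \<open>EE\<^sup>*\<close> onto
  \<open>range E\<close>, \<open>fam_ops \<F>\<close> consists of those \<open>T\<close> with \<open>T(I\<^sub>E) \<subseteq> range E\<close> for every \<open>E\<close>
  (\<open>mem_fam_ops_iff\<close>), while the nest algebra consists of those with
  \<open>T(range E) \<subseteq> range E\<close>. Composing an operator of the second kind after one of the first gives one
  of the first; so the only question for (iii) implying (ii) is inclusion in the nest algebra, and
  there \<open>range E \<subseteq> I\<^sub>E\<close> gives \<open>T(range E) \<subseteq> T(I\<^sub>E) \<subseteq> range E\<close>. A left ideal of an algebra containing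
  it is closed under products, so (ii) implies (i).

  The content is in (i) implying (iii). Suppose that \<open>E\<close> has a range which neither lies in \<open>I\<^sub>E\<close> nor
  is the whole space. A rank-one operator \<open>x \<mapsto> \<langle>x, u\<rangle> y\<close> is in \<open>fam_ops \<F>\<close> as soon as every
  member \<open>G\<close> satisfies \<open>u \<bottom> I\<^sub>G\<close> or \<open>y \<in> range G\<close>. Initial and final spaces increase along the
  ordering, so the first alternative is wanted for small \<open>G\<close> and the second for large \<open>G\<close>. Two such
  operators are found: one moves some \<open>u \<in> I\<^sub>E\<close> to a vector \<open>y \<notin> I\<^sub>E\<close>
  (\<open>rank_one_out_of_initial_space\<close>), the other moves \<open>y\<close> to a nonzero multiple of a vector outside
  \<open>range E\<close> (\<open>rank_one_out_of_range\<close>). Their product maps \<open>u \<in> I\<^sub>E\<close> out of \<open>range E\<close>, so it is not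
  in \<open>fam_ops \<F>\<close>. Each of the two constructions depends on whether \<open>E\<close> is separated from the members
  strictly below it, respectively strictly above it, or is a limit of them.

  The underlying Hilbert space theory (nearest points, the Riesz representation, adjoints) is derived
  from completeness.
\<close>

section \<open>The complex inner product\<close>

lemma cinner_add_right:
  "cinner (x::'a::complex_hilbert_space) (y + z) = cinner x y + cinner x z"
  by (metis cinner_commute cinner_add_left complex_cnj_add)

lemma cinner_scaleC_right:
  "cinner (x::'a::complex_hilbert_space) (c *\<^sub>C y) = cnj c * cinner x y"
  by (metis cinner_commute cinner_scaleC_left complex_cnj_mult)

lemma cinner_zero_left [simp]: "cinner (0::'a::complex_hilbert_space) x = 0"
  using cinner_add_left[of 0 0 x] by simp

lemma cinner_zero_right [simp]: "cinner (x::'a::complex_hilbert_space) 0 = 0"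
  using cinner_add_right[of x 0 0] by simp

lemma cinner_diff_left:
  "cinner (x - y) z = cinner x z - cinner (y::'a::complex_hilbert_space) z"
  using cinner_add_left[of "x - y" y z] by simp

lemma cinner_diff_right:
  "cinner z (x - y) = cinner z x - cinner z (y::'a::complex_hilbert_space)"
  using cinner_add_right[of z "x - y" y] by simp

lemma cinner_eq_zero_commute:
  "cinner x y = 0 \<longleftrightarrow> cinner (y::'a::complex_hilbert_space) x = 0"
  by (metis cinner_commute complex_cnj_zero)

lemma Im_cinner: "Im (cinner x y) = inner (x::'a::complex_hilbert_space) (\<i> *\<^sub>C y)"
  by (simp add: re_cinner[symmetric] cinner_scaleC_right)

lemma cinner_self: "cinner (x::'a::complex_hilbert_space) x = of_real ((norm x)\<^sup>2)"
proof (rule complex_eqI)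
  show "Re (cinner x x) = Re (of_real ((norm x)\<^sup>2))"
    by (simp add: re_cinner power2_norm_eq_inner)
  have "Im (cinner x x) = - Im (cinner x x)"
    using arg_cong[OF cinner_commute[of x x], of Im] by simp
  then show "Im (cinner x x) = Im (of_real ((norm x)\<^sup>2))"
    by simp
qed

lemma cinner_self_eq_zero [simp]: "cinner x x = 0 \<longleftrightarrow> x = (0::'a::complex_hilbert_space)"
  by (simp add: cinner_self)

lemma scaleC_eq_zero_iff: "c *\<^sub>C x = 0 \<longleftrightarrow> c = 0 \<or> x = (0::'a::complex_hilbert_space)"
proof -
  have "cinner (c *\<^sub>C x) (c *\<^sub>C x) = c * cnj c * cinner x x"
    by (simp add: cinner_scaleC_left cinner_scaleC_right)
  then show ?thesis
    by (metis cinner_self_eq_zero complex_cnj_zero_iff mult_eq_0_iff)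
qed

lemma norm_scaleC: "norm (c *\<^sub>C x) = cmod c * norm (x::'a::complex_hilbert_space)"
proof -
  have "complex_of_real ((norm (c *\<^sub>C x))\<^sup>2) = c * cnj c * of_real ((norm x)\<^sup>2)"
    by (simp only: cinner_self[symmetric] cinner_scaleC_left cinner_scaleC_right mult_ac)
  also have "\<dots> = of_real ((cmod c * norm x)\<^sup>2)"
    by (simp add: complex_norm_square[symmetric] power_mult_distrib)
  finally have "(norm (c *\<^sub>C x))\<^sup>2 = (cmod c * norm x)\<^sup>2"
    by (simp only: of_real_eq_iff)
  then show ?thesis
    by (simp add: power2_eq_iff_nonneg)
qed

text \<open>Real and imaginary parts are estimated separately, whence the factor 2; it is harmless for the
  boundedness of rank-one operators.\<close>

lemma norm_cinner_le: "cmod (cinner x y) \<le> 2 * norm (x::'a::complex_hilbert_space) * norm y"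
proof -
  have "cmod (cinner x y) \<le> \<bar>inner x y\<bar> + \<bar>inner x (\<i> *\<^sub>C y)\<bar>"
    using cmod_le[of "cinner x y"] by (simp add: re_cinner Im_cinner)
  also have "\<dots> \<le> norm x * norm y + norm x * norm (\<i> *\<^sub>C y)"
    by (intro add_mono Cauchy_Schwarz_ineq2)
  finally show ?thesis
    by (simp add: norm_scaleC)
qed

lemma cinner_eqI:
  assumes "\<And>x::'a::complex_hilbert_space. cinner x y = cinner x z"
  shows "y = z"
  using assms[of "y - z"] cinner_self_eq_zero[of "y - z"] by (simp add: cinner_diff_right)

lemma orth_compl_diff: "x \<in> orth_compl S \<Longrightarrow> y \<in> orth_compl S \<Longrightarrow> x - y \<in> orth_compl S"
  by (simp add: orth_compl_def cinner_diff_left)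

section \<open>Orthogonal projection and adjoints\<close>

text \<open>A minimizing sequence is Cauchy by the parallelogram law, because the midpoint of two of
  its terms stays in the set.\<close>

lemma nearest_point_exists:
  fixes S :: "'a::{real_inner, complete_space} set"
  assumes "closed S" "convex S" "S \<noteq> {}"
  shows "\<exists>p\<in>S. \<forall>s\<in>S. norm (x - p) \<le> norm (x - s)"
proof -
  define d where "d = infdist x S"
  have d_le: "d \<le> norm (x - s)" if "s \<in> S" for s
    using infdist_le[OF that, of x] by (simp add: d_def dist_norm)
  have d0: "0 \<le> d"
    by (simp add: d_def infdist_nonneg)
  have "\<exists>s\<in>S. norm (x - s) < d + inverse (real (Suc n))" for n
  proof (rule ccontr)
    assume "\<not> ?thesis"
    then have "\<And>s. s \<in> S \<Longrightarrow> d + inverse (real (Suc n)) \<le> dist x s"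
      by (force simp: dist_norm not_less)
    then have "d + inverse (real (Suc n)) \<le> infdist x S"
      using \<open>S \<noteq> {}\<close> by (simp add: infdist_def cINF_greatest)
    then show False
      unfolding d_def by simp
  qed
  then obtain f where f: "\<And>n. f n \<in> S" "\<And>n. norm (x - f n) < d + inverse (real (Suc n))"
    by metis
  have par: "(norm (f m - f n))\<^sup>2 \<le> 2 * (norm (x - f m))\<^sup>2 + 2 * (norm (x - f n))\<^sup>2 - 4 * d\<^sup>2" for m n
  proof -
    have "(1/2) *\<^sub>R f m + (1/2) *\<^sub>R f n \<in> S"
      using \<open>convex S\<close> f(1) by (intro convexD) auto
    then have "d \<le> norm (x - ((1/2) *\<^sub>R f m + (1/2) *\<^sub>R f n))"
      by (rule d_le)
    then have "d\<^sup>2 \<le> (norm (x - ((1/2) *\<^sub>R f m + (1/2) *\<^sub>R f n)))\<^sup>2"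
      using d0 by (intro power_mono)
    then show ?thesis
      unfolding power2_norm_eq_inner
      by (simp add: inner_diff_left inner_diff_right inner_add_left inner_add_right inner_commute
          algebra_simps)
  qed
  have lim: "(\<lambda>n. norm (x - f n)) \<longlonglongrightarrow> d"
  proof (rule tendsto_sandwich)
    show "\<forall>\<^sub>F n in sequentially. d \<le> norm (x - f n)"
      using d_le f(1) by simp
    show "\<forall>\<^sub>F n in sequentially. norm (x - f n) \<le> d + inverse (real (Suc n))"
      using f(2) by (simp add: less_imp_le)
    show "(\<lambda>n. d + inverse (real (Suc n))) \<longlonglongrightarrow> d"
      using tendsto_add[OF tendsto_const LIMSEQ_inverse_real_of_nat, of d] by simp
  qed simp
  have "Cauchy f"
  proof (rule CauchyI)
    fix e :: real
    assume "0 < e"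
    have "(\<lambda>n. (norm (x - f n))\<^sup>2) \<longlonglongrightarrow> d\<^sup>2"
      using lim by (intro tendsto_intros)
    then have "\<forall>\<^sub>F n in sequentially. (norm (x - f n))\<^sup>2 < d\<^sup>2 + e\<^sup>2 / 4"
      using \<open>0 < e\<close> by (intro order_tendstoD) auto
    then obtain N where N: "\<And>n. n \<ge> N \<Longrightarrow> (norm (x - f n))\<^sup>2 < d\<^sup>2 + e\<^sup>2 / 4"
      unfolding eventually_sequentially by blast
    have "norm (f m - f n) < e" if "m \<ge> N" "n \<ge> N" for m n
    proof -
      have "(norm (f m - f n))\<^sup>2 < e\<^sup>2"
        using par[of m n] N[OF that(1)] N[OF that(2)] by argo
      then show ?thesis
        using \<open>0 < e\<close> by (simp add: power_less_imp_less_base)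
    qed
    then show "\<exists>M. \<forall>m\<ge>M. \<forall>n\<ge>M. norm (f m - f n) < e"
      by blast
  qed
  then obtain p where p: "f \<longlonglongrightarrow> p"
    using Cauchy_convergent_iff convergent_def by blast
  then have "p \<in> S"
    using \<open>closed S\<close> f(1) closed_sequentially by blast
  moreover have "norm (x - p) = d"
    using p lim by (intro LIMSEQ_unique[OF _ lim] tendsto_intros)
  ultimately show ?thesis
    using d_le by blast
qed

lemma nearest_point_orthogonal:
  fixes S :: "'a::real_inner set"
  assumes "subspace S" "p \<in> S" "\<And>s. s \<in> S \<Longrightarrow> norm (x - p) \<le> norm (x - s)" "s \<in> S"
  shows "inner (x - p) s = 0"
proof (cases "s = 0")
  case False
  define t where "t = inner (x - p) s / inner s s"
  have ss: "inner s s > 0"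
    using False by simp
  have "p + t *\<^sub>R s \<in> S"
    using assms by (simp add: subspace_add subspace_scale)
  then have "(norm (x - p))\<^sup>2 \<le> (norm ((x - p) - t *\<^sub>R s))\<^sup>2"
    using assms(3) by (intro power_mono) (auto simp: diff_diff_eq)
  also have "\<dots> = (norm (x - p))\<^sup>2 - 2 * t * inner (x - p) s + t\<^sup>2 * inner s s"
  proof -
    have "(norm (r - t *\<^sub>R s))\<^sup>2 = (norm r)\<^sup>2 - 2 * t * inner r s + t\<^sup>2 * inner s s" for r
      unfolding power2_norm_eq_inner
      by (simp add: inner_diff_left inner_diff_right inner_commute[of s r] power2_eq_square
          right_diff_distrib)
    then show ?thesis .
  qed
  also have "\<dots> = (norm (x - p))\<^sup>2 - (inner (x - p) s)\<^sup>2 / inner s s"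
    using ss by (simp add: t_def power2_eq_square field_simps)
  finally have "(inner (x - p) s)\<^sup>2 \<le> 0"
    using ss by (simp add: divide_le_0_iff)
  then show ?thesis
    by simp
qed simp

lemma bounded_ops_linear: "T \<in> bounded_ops \<Longrightarrow> bounded_linear T"
  by (simp add: bounded_ops_def)

lemma bounded_ops_add: "T \<in> bounded_ops \<Longrightarrow> T (x + y) = T x + T y"
  by (simp add: bounded_ops_def bounded_linear.linear linear_add)

lemma bounded_ops_diff: "T \<in> bounded_ops \<Longrightarrow> T (x - y) = T x - T y"
  by (simp add: bounded_ops_def bounded_linear.linear linear_diff)

lemma bounded_ops_zero: "T \<in> bounded_ops \<Longrightarrow> T 0 = 0"
  by (simp add: bounded_ops_def bounded_linear.linear linear_0)

lemma bounded_ops_scaleC: "T \<in> bounded_ops \<Longrightarrow> T (c *\<^sub>C x) = c *\<^sub>C T x"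
  by (simp add: bounded_ops_def)

lemma bounded_linear_kernel_decomp:
  fixes f :: "'a::{real_inner, complete_space} \<Rightarrow> 'b::real_normed_vector"
  assumes "bounded_linear f"
  obtains k where "f k = 0" "\<And>s. f s = 0 \<Longrightarrow> inner (x - k) s = 0"
proof -
  have lin: "linear f"
    using assms by (rule bounded_linear.linear)
  have sub: "subspace {x. f x = 0}"
    using lin by (simp add: linear_subspace_kernel)
  have "closed {x. f x = 0}"
    using linear_continuous_on[OF assms, of UNIV]
    by (intro closed_Collect_eq) auto
  then obtain p where "p \<in> {x. f x = 0}" "\<forall>s\<in>{x. f x = 0}. norm (x - p) \<le> norm (x - s)"
    using nearest_point_exists[of "{x. f x = 0}" x] sub subspace_imp_convex subspace_0 by blast
  then show thesis
    using nearest_point_orthogonal[OF sub, of p x] that[of p] by blast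
qed

text \<open>A nonzero functional is determined by its kernel and one vector orthogonal to the kernel,
  so a multiple of that vector represents it.\<close>

lemma riesz_representation:
  fixes f :: "'a::{real_inner, complete_space} \<Rightarrow> real"
  assumes "bounded_linear f"
  shows "\<exists>z. \<forall>x. f x = inner x z"
proof (cases "\<forall>x. f x = 0")
  case True
  then show ?thesis
    by (auto intro: exI[of _ 0])
next
  case False
  then obtain a where a: "f a \<noteq> 0"
    by blast
  have lin: "linear f"
    using assms by (rule bounded_linear.linear)
  obtain k where k: "f k = 0" "\<And>s. f s = 0 \<Longrightarrow> inner (a - k) s = 0"
    using bounded_linear_kernel_decomp[OF assms] by blast
  define w where "w = a - k"
  have fw: "f w \<noteq> 0"
    using a k(1) by (simp add: w_def linear_diff[OF lin])
  then have ww: "inner w w \<noteq> 0"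
    using linear_0[OF lin] by auto
  have "f x = inner x ((f w / inner w w) *\<^sub>R w)" for x
  proof -
    have "f (x - (f x / f w) *\<^sub>R w) = 0"
      using fw by (simp add: linear_diff[OF lin] linear_scale[OF lin])
    then have "inner w (x - (f x / f w) *\<^sub>R w) = 0"
      using k(2) by (simp add: w_def)
    then have "inner x w = f x / f w * inner w w"
      by (simp add: inner_diff_right inner_commute)
    then show ?thesis
      using fw ww by simp
  qed
  then show ?thesis
    by blast
qed

text \<open>The real adjoint is already the complex one: the imaginary part of the inner product is the
  real inner product against \<open>\<i>\<close> times a vector.\<close>

lemma adjoint_exists:
  fixes T :: "'a::complex_hilbert_space \<Rightarrow> 'a"
  assumes T: "T \<in> bounded_ops"
  shows "\<exists>S\<in>bounded_ops. \<forall>x y. cinner (T x) y = cinner x (S y)"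
proof -
  have "\<exists>z. \<forall>x. inner (T x) y = inner x z" for y
    by (intro riesz_representation bounded_linear_compose[OF bounded_linear_inner_left]
        bounded_ops_linear T)
  then obtain S where S: "\<And>x y. inner (T x) y = inner x (S y)"
    by metis
  have adj: "cinner (T x) y = cinner x (S y)" for x y
  proof (rule complex_eqI)
    have rot: "Im (cinner u v) = - Re (cinner (\<i> *\<^sub>C u) v)" for u v :: 'a
      by (simp add: cinner_scaleC_left)
    show "Re (cinner (T x) y) = Re (cinner x (S y))"
      by (simp add: re_cinner S)
    have "Re (cinner (\<i> *\<^sub>C T x) y) = Re (cinner (\<i> *\<^sub>C x) (S y))"
      unfolding bounded_ops_scaleC[OF T, symmetric] re_cinner by (rule S)
    then show "Im (cinner (T x) y) = Im (cinner x (S y))"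
      by (simp only: rot)
  qed
  have add: "S (y + z) = S y + S z" for y z
    by (rule cinner_eqI) (simp add: adj[symmetric] cinner_add_right)
  have scale: "S (c *\<^sub>C y) = c *\<^sub>C S y" for c y
    by (rule cinner_eqI) (simp add: adj[symmetric] cinner_scaleC_right)
  obtain K where K: "\<And>x. norm (T x) \<le> norm x * K"
    using bounded_linear.bounded[OF bounded_ops_linear[OF T]] by blast
  have "norm (S y) \<le> norm y * K" for y
  proof (cases "S y = 0")
    case True
    have "0 \<le> norm (T y)" by simp
    also have "\<dots> \<le> norm y * K" by (rule K)
    finally show ?thesis
      using True by simp
  next
    case False
    have "norm (S y) * norm (S y) = inner (T (S y)) y"
      by (simp add: S power2_norm_eq_inner[symmetric] power2_eq_square)
    also have "\<dots> \<le> norm (T (S y)) * norm y"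
      by (rule norm_cauchy_schwarz)
    also have "\<dots> \<le> norm (S y) * K * norm y"
      by (intro mult_right_mono K) simp
    finally show ?thesis
      using False by (simp add: mult.assoc mult.commute)
  qed
  then have "bounded_linear S"
    by (intro bounded_linear_intro[of S K] add)
      (simp_all add: scale scaleC_of_real[symmetric])
  with scale adj show ?thesis
    by (auto simp: bounded_ops_def)
qed

lemma cinner_adj:
  fixes T :: "'a::complex_hilbert_space \<Rightarrow> 'a"
  assumes "T \<in> bounded_ops"
  shows "cinner (T x) y = cinner x (adj T y)"
proof -
  have "\<exists>!S. S \<in> bounded_ops \<and> (\<forall>x y. cinner (T x) y = cinner x (S y))"
    using adjoint_exists[OF assms] by (metis cinner_eqI ext)
  from theI'[OF this] show ?thesis
    unfolding adj_def by blast
qed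

section \<open>Initial and final spaces of a partial isometry\<close>

lemma partial_isometry_bounded_ops: "partial_isometry E \<Longrightarrow> E \<in> bounded_ops"
  by (simp add: partial_isometry_def)

lemma cinner_initial_kernel: "p \<in> initial_space E \<Longrightarrow> k \<in> kernel E \<Longrightarrow> cinner p k = 0"
  by (simp add: initial_space_def orth_compl_def)

lemma kernel_initial_decomp:
  fixes E :: "'a::complex_hilbert_space \<Rightarrow> 'a"
  assumes "E \<in> bounded_ops"
  obtains k p where "x = k + p" "k \<in> kernel E" "p \<in> initial_space E"
proof -
  obtain k where k: "E k = 0" "\<And>s. E s = 0 \<Longrightarrow> inner (x - k) s = 0"
    using bounded_linear_kernel_decomp[OF bounded_ops_linear[OF assms]] by blast
  have "cinner (x - k) s = 0" if "E s = 0" for s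
  proof (rule complex_eqI)
    have "E (\<i> *\<^sub>C s) = 0"
      using that by (simp add: bounded_ops_scaleC[OF assms] scaleC_eq_zero_iff)
    then show "Im (cinner (x - k) s) = Im 0"
      by (simp add: Im_cinner k(2))
    show "Re (cinner (x - k) s) = Re 0"
      using that by (simp add: re_cinner k(2))
  qed
  then have "x - k \<in> initial_space E"
    by (simp add: initial_space_def orth_compl_def kernel_def)
  then show thesis
    using that[of k "x - k"] k(1) by (simp add: kernel_def)
qed

text \<open>By Pythagoras, a nonzero component in the kernel makes \<open>E\<close> strictly shorten a vector. This
  is what forces initial spaces to be nested: \<open>hm_le\<close> only says that the two operators agree.\<close>

lemma mem_initial_space_iff_norm:
  assumes E: "partial_isometry E"
  shows "x \<in> initial_space E \<longleftrightarrow> norm (E x) = norm x"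
proof
  assume "x \<in> initial_space E"
  then show "norm (E x) = norm x"
    using E by (simp add: partial_isometry_def)
next
  assume eq: "norm (E x) = norm x"
  have bE: "E \<in> bounded_ops"
    using E by (rule partial_isometry_bounded_ops)
  obtain k p where x: "x = k + p" and k: "k \<in> kernel E" and p: "p \<in> initial_space E"
    using bE kernel_initial_decomp by blast
  have "E x = E p"
    using x k by (simp add: bounded_ops_add[OF bE] kernel_def)
  then have np: "norm x = norm p"
    using eq p E by (simp add: partial_isometry_def)
  have "inner k p = 0" "inner p k = 0"
    using cinner_initial_kernel[OF p k] cinner_eq_zero_commute[of p k]
    by (simp_all flip: re_cinner)
  then have "(norm x)\<^sup>2 = (norm k)\<^sup>2 + (norm p)\<^sup>2"
    unfolding x power2_norm_eq_inner by (simp add: inner_add_left inner_add_right)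
  then show "x \<in> initial_space E"
    using np x p by simp
qed

lemma initial_space_diff:
  "x \<in> initial_space E \<Longrightarrow> y \<in> initial_space E \<Longrightarrow> x - y \<in> initial_space E"
  unfolding initial_space_def by (rule orth_compl_diff)

lemma inj_on_initial_space:
  assumes E: "partial_isometry E"
  shows "inj_on E (initial_space E)"
proof (rule inj_onI)
  fix x y
  assume "x \<in> initial_space E" "y \<in> initial_space E" "E x = E y"
  moreover have "norm (E (x - y)) = norm (x - y)"
    using calculation initial_space_diff[of x E y] mem_initial_space_iff_norm[OF E] by blast
  ultimately show "x = y"
    by (simp add: bounded_ops_diff[OF partial_isometry_bounded_ops[OF E]])
qed

lemma range_eq_image_initial_space:
  assumes "E \<in> bounded_ops"
  shows "range E = E ` initial_space E"
proof -
  have "E x \<in> E ` initial_space E" for x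
  proof -
    obtain k p where "x = k + p" "k \<in> kernel E" "p \<in> initial_space E"
      using assms kernel_initial_decomp by blast
    then show ?thesis
      by (simp add: bounded_ops_add[OF assms] kernel_def)
  qed
  then show ?thesis
    by auto
qed

text \<open>By polarization a partial isometry preserves inner products on its initial space, and both
  sides vanish when one argument is in the kernel; hence \<open>E\<^sup>*E\<close> is the identity on the
  initial space.\<close>

lemma init_proj_initial:
  assumes E: "partial_isometry E" and p: "p \<in> initial_space E"
  shows "init_proj E p = p"
proof -
  have bE: "E \<in> bounded_ops"
    using E by (rule partial_isometry_bounded_ops)
  have real_inner_preserved: "inner (E q) (E r) = inner q r"
    if "q \<in> initial_space E" "r \<in> initial_space E" for q r
  proof -
    have "norm (E (q - r)) = norm (q - r)" "norm (E q) = norm q" "norm (E r) = norm r"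
      using that initial_space_diff[of q E r] mem_initial_space_iff_norm[OF E] by blast+
    then have "inner (E q - E r) (E q - E r) = inner (q - r) (q - r)"
        "inner (E q) (E q) = inner q q" "inner (E r) (E r) = inner r r"
      by (simp_all add: bounded_ops_diff[OF bE] flip: power2_norm_eq_inner)
    moreover have "inner (a - b) (a - b) = inner a a + inner b b - 2 * inner a b" for a b :: 'a
      by (simp add: inner_diff_left inner_diff_right inner_commute)
    ultimately show ?thesis
      by simp
  qed
  have scaled: "\<i> *\<^sub>C p \<in> initial_space E"
    using p by (simp add: initial_space_def orth_compl_def cinner_scaleC_left)
  have "cinner (E q) (E p) = cinner q p" if "q \<in> initial_space E" for q
    using real_inner_preserved[OF that p] real_inner_preserved[OF that scaled]
    by (intro complex_eqI) (simp_all add: re_cinner Im_cinner bounded_ops_scaleC[OF bE])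
  moreover have "cinner k p = 0" if "k \<in> kernel E" for k
    using cinner_initial_kernel[OF p that] by (simp add: cinner_eq_zero_commute)
  ultimately have "cinner x (adj E (E p)) = cinner x p" for x
    using kernel_initial_decomp[OF bE, of x "cinner (E x) (E p) = cinner x p"]
    by (simp add: bounded_ops_add[OF bE] kernel_def cinner_add_left flip: cinner_adj[OF bE])
  then show ?thesis
    unfolding init_proj_def o_def by (rule cinner_eqI)
qed

lemma adj_in_initial_space:
  assumes "E \<in> bounded_ops"
  shows "adj E y \<in> initial_space E"
proof -
  have "cinner k (adj E y) = 0" if "E k = 0" for k
    using that cinner_adj[OF assms, of k y] by simp
  then show ?thesis
    by (simp add: initial_space_def orth_compl_def kernel_def cinner_eq_zero_commute)
qed

lemma range_init_proj:
  assumes E: "partial_isometry E"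
  shows "range (init_proj E) = initial_space E"
proof
  show "range (init_proj E) \<subseteq> initial_space E"
    using adj_in_initial_space[OF partial_isometry_bounded_ops[OF E]]
    by (auto simp: init_proj_def)
  show "initial_space E \<subseteq> range (init_proj E)"
    using init_proj_initial[OF E] by (metis rangeI subsetI)
qed

lemma final_proj_fixed_iff:
  assumes E: "partial_isometry E"
  shows "final_proj E y = y \<longleftrightarrow> y \<in> range E"
proof
  assume "final_proj E y = y"
  then show "y \<in> range E"
    by (metis comp_apply final_proj_def rangeI)
next
  assume "y \<in> range E"
  then obtain p where "y = E p" "p \<in> initial_space E"
    using range_eq_image_initial_space[OF partial_isometry_bounded_ops[OF E]] by auto
  then show "final_proj E y = y"
    using init_proj_initial[OF E] by (simp add: final_proj_def init_proj_def)
qed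

lemma range_final_proj:
  assumes E: "partial_isometry E"
  shows "range (final_proj E) = range E"
proof
  show "range (final_proj E) \<subseteq> range E"
    by (auto simp: final_proj_def)
  show "range E \<subseteq> range (final_proj E)"
    using final_proj_fixed_iff[OF E] by (metis rangeI subsetI)
qed

lemma range_bounded_op_subspace:
  assumes "E \<in> bounded_ops"
  shows "0 \<in> range E"
    and "x \<in> range E \<Longrightarrow> y \<in> range E \<Longrightarrow> x + y \<in> range E"
    and "x \<in> range E \<Longrightarrow> c *\<^sub>C x \<in> range E"
  using rangeI[of E 0]
  by (auto simp: bounded_ops_zero[OF assms]
      simp flip: bounded_ops_add[OF assms] bounded_ops_scaleC[OF assms])

section \<open>The Halmos--McLaughlin ordering\<close>

lemma hm_le_initial_space_mono:
  assumes "partial_isometry E" "partial_isometry F" "hm_le E F"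
  shows "initial_space E \<subseteq> initial_space F"
  using assms by (auto simp: mem_initial_space_iff_norm hm_le_def)

lemma hm_le_range_mono:
  assumes "partial_isometry E" "hm_le E F"
  shows "range E \<subseteq> range F"
proof -
  have "E ` initial_space E = F ` initial_space E"
    using \<open>hm_le E F\<close> by (simp add: hm_le_def)
  then show ?thesis
    unfolding range_eq_image_initial_space[OF partial_isometry_bounded_ops[OF assms(1)]]
    by blast
qed

lemma hm_le_kernel_antimono:
  assumes E: "partial_isometry E" and F: "partial_isometry F" and "hm_le E F"
  shows "kernel F \<subseteq> kernel E"
proof
  fix x
  assume x: "x \<in> kernel F"
  obtain k p where kp: "x = k + p" "k \<in> kernel E" "p \<in> initial_space E"
    using kernel_initial_decomp[OF partial_isometry_bounded_ops[OF E]] by blast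
  have "cinner p x = 0"
    using kp(3) x hm_le_initial_space_mono[OF assms] cinner_initial_kernel by blast
  then have "cinner p p = 0"
    using kp cinner_initial_kernel[OF kp(3,2)] by (simp add: cinner_add_right)
  then show "x \<in> kernel E"
    using kp by simp
qed

lemma hm_less_initial_space:
  assumes "hm_le E F" "\<not> hm_le F E"
  shows "\<exists>x. x \<in> initial_space F \<and> x \<notin> initial_space E"
  using assms unfolding hm_le_def by metis

text \<open>A vector of \<open>range E\<close> is the image under \<open>F\<close> of some vector in the initial space of \<open>E\<close>, and
  \<open>F\<close> has only one preimage of it in its own initial space.\<close>

lemma hm_le_preimage_in_initial_space:
  assumes E: "partial_isometry E" and F: "partial_isometry F" and "hm_le E F"
    and x: "x \<in> initial_space F" and "F x \<in> range E"
  shows "x \<in> initial_space E"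
proof -
  obtain w where w: "w \<in> initial_space E" "F x = E w"
    using assms(5) range_eq_image_initial_space[OF partial_isometry_bounded_ops[OF E]] by auto
  then have "F x = F w" "w \<in> initial_space F"
    using \<open>hm_le E F\<close> hm_le_initial_space_mono[OF E F] by (auto simp: hm_le_def)
  then show ?thesis
    using inj_onD[OF inj_on_initial_space[OF F]] x w(1) by metis
qed

lemma hm_less_range:
  assumes "partial_isometry E" "partial_isometry F" "hm_le E F" "\<not> hm_le F E"
  shows "\<exists>z. z \<in> range F \<and> z \<notin> range E"
  using hm_less_initial_space[OF assms(3,4)] hm_le_preimage_in_initial_space[OF assms(1-3)]
  by (metis rangeI)

lemma hm_less_orthogonal_vector:
  assumes F: "partial_isometry F" and E: "partial_isometry E" and "hm_le F E" "\<not> hm_le E F"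
  obtains u where "u \<in> initial_space E" "u \<in> kernel F" "u \<noteq> 0"
proof -
  obtain x where x: "x \<in> initial_space E" "x \<notin> initial_space F"
    using hm_less_initial_space assms by blast
  obtain k p where kp: "x = k + p" "k \<in> kernel F" "p \<in> initial_space F"
    using kernel_initial_decomp[OF partial_isometry_bounded_ops[OF F]] by blast
  have "p \<in> initial_space E"
    using hm_le_initial_space_mono[OF F E \<open>hm_le F E\<close>] kp(3) by blast
  then have "k \<in> initial_space E"
    using initial_space_diff[OF x(1)] kp(1) by fastforce
  moreover have "k \<noteq> 0"
    using x(2) kp by auto
  ultimately show thesis
    using that kp(2) by blast
qed

section \<open>The operators attached to a family\<close>

lemma mem_fam_ops_iff:
  assumes "\<forall>E\<in>\<F>. partial_isometry E"
  shows "T \<in> fam_ops \<F> \<longleftrightarrow> T \<in> bounded_ops \<and> (\<forall>E\<in>\<F>. T ` initial_space E \<subseteq> range E)"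
proof -
  have "(\<forall>x. T (init_proj E x) - final_proj E (T (init_proj E x)) = 0) \<longleftrightarrow>
      T ` initial_space E \<subseteq> range E" if "E \<in> \<F>" for E
  proof -
    have E: "partial_isometry E"
      using assms that by blast
    have "T y - final_proj E (T y) = 0 \<longleftrightarrow> T y \<in> range E" for y
      using final_proj_fixed_iff[OF E, of "T y"] by (metis eq_iff_diff_eq_0)
    then show ?thesis
      by (simp add: image_subset_iff flip: range_init_proj[OF E])
  qed
  then show ?thesis
    by (auto simp: fam_ops_def)
qed

lemma mem_nest_algebra_final_nest_iff:
  assumes "\<forall>E\<in>\<F>. partial_isometry E"
  shows "T \<in> nest_algebra (final_nest \<F>) \<longleftrightarrow>
    T \<in> bounded_ops \<and> (\<forall>E\<in>\<F>. T ` range E \<subseteq> range E)"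
proof -
  have "(\<forall>P\<in>final_proj ` \<F>. T ` range P \<subseteq> range P) \<longleftrightarrow> (\<forall>E\<in>\<F>. T ` range E \<subseteq> range E)"
    using assms by (simp add: range_final_proj)
  moreover have "T ` range (\<lambda>x. 0) \<subseteq> range (\<lambda>x. 0)" if "T \<in> bounded_ops"
    using bounded_ops_zero[OF that] by auto
  ultimately show ?thesis
    unfolding nest_algebra_def final_nest_def by auto
qed

lemma bounded_ops_compose: "S \<in> bounded_ops \<Longrightarrow> T \<in> bounded_ops \<Longrightarrow> S \<circ> T \<in> bounded_ops"
  using bounded_linear_compose[of S T] by (simp add: bounded_ops_def o_def)

lemma bounded_linear_scaleC: "bounded_linear (\<lambda>x. c *\<^sub>C (x::'a::complex_hilbert_space))"
  by (rule bounded_linear_intro[of _ "cmod c"])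
    (simp_all add: scaleC_add_right norm_scaleC scaleC_scaleC mult.commute flip: scaleC_of_real)

lemma op_subspace_fam_ops:
  assumes F: "\<forall>E\<in>\<F>. partial_isometry E"
  shows "op_subspace (fam_ops \<F>)"
proof -
  have sub: "0 \<in> range E"
      "\<And>x y. x \<in> range E \<Longrightarrow> y \<in> range E \<Longrightarrow> x + y \<in> range E"
      "\<And>x c. x \<in> range E \<Longrightarrow> c *\<^sub>C x \<in> range E" if "E \<in> \<F>" for E
    using range_bounded_op_subspace[OF partial_isometry_bounded_ops[OF bspec[OF F that]]] by simp_all
  have "(\<lambda>x. 0) \<in> bounded_ops"
    by (simp add: bounded_ops_def scaleC_eq_zero_iff)
  moreover have "(\<lambda>x. S x + T x) \<in> bounded_ops" if "S \<in> bounded_ops" "T \<in> bounded_ops"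
    for S T :: "'a \<Rightarrow> 'a"
    using that by (simp add: bounded_ops_def bounded_linear_add scaleC_add_right)
  moreover have "(\<lambda>x. c *\<^sub>C T x) \<in> bounded_ops" if "T \<in> bounded_ops"
    for c and T :: "'a \<Rightarrow> 'a"
    using that bounded_linear_compose[OF bounded_linear_scaleC, of T c]
    by (simp add: bounded_ops_def scaleC_scaleC mult.commute)
  ultimately show ?thesis
    using sub by (auto simp: op_subspace_def mem_fam_ops_iff[OF F] image_subset_iff)
qed

definition rank_one :: "'a::complex_hilbert_space \<Rightarrow> 'a \<Rightarrow> 'a \<Rightarrow> 'a" where
  "rank_one u y x = cinner x u *\<^sub>C y"

lemma rank_one_bounded_ops: "rank_one u y \<in> bounded_ops"
proof -
  have "bounded_linear (rank_one u y)"
  proof (rule bounded_linear_intro[of _ "2 * norm u * norm y"])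
    fix x
    have "cmod (cinner x u) * norm y \<le> 2 * norm x * norm u * norm y"
      by (intro mult_right_mono norm_cinner_le) simp
    then show "norm (rank_one u y x) \<le> norm x * (2 * norm u * norm y)"
      by (simp add: rank_one_def norm_scaleC mult_ac)
  qed (simp_all add: rank_one_def cinner_add_left scaleC_add_left cinner_scaleC_left
      scaleC_scaleC flip: scaleC_of_real)
  then show ?thesis
    by (simp add: bounded_ops_def rank_one_def cinner_scaleC_left scaleC_scaleC)
qed

lemma rank_one_in_fam_ops:
  assumes F: "\<forall>E\<in>\<F>. partial_isometry E"
    and cases: "\<And>E. E \<in> \<F> \<Longrightarrow> u \<in> kernel E \<or> y \<in> range E"
  shows "rank_one u y \<in> fam_ops \<F>"
proof -
  have "cinner x u *\<^sub>C y \<in> range E" if E: "E \<in> \<F>" and x: "x \<in> initial_space E" for E x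
  proof -
    have bE: "E \<in> bounded_ops"
      using F E partial_isometry_bounded_ops by blast
    show ?thesis
      using cases[OF E]
    proof
      assume "u \<in> kernel E"
      then have "cinner x u *\<^sub>C y = 0"
        using x by (simp add: cinner_initial_kernel scaleC_eq_zero_iff)
      then show ?thesis
        using range_bounded_op_subspace(1)[OF bE] by simp
    qed (rule range_bounded_op_subspace(3)[OF bE])
  qed
  then show ?thesis
    by (auto simp: mem_fam_ops_iff[OF F] rank_one_bounded_ops rank_one_def)
qed

section \<open>Rank-one operators violating closure under products\<close>

text \<open>Fix \<open>E x\<close> outside the initial space of \<open>E\<close> and let \<open>v\<close> be its component in \<open>ker E\<close>. Since
  \<open>\<langle>E q, v\<rangle> = \<langle>q, E\<^sup>*v\<rangle>\<close>, there are two cases. If \<open>E\<^sup>*v\<close> is orthogonal to all initial spaces strictly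
  below, then \<open>u = E\<^sup>*v\<close> and \<open>y = E x\<close> will do. If not, some \<open>F\<close> strictly below \<open>E\<close> has a vector \<open>q\<close>
  in its initial space with \<open>\<langle>E q, v\<rangle> \<noteq> 0\<close>; then \<open>y = E q = F q\<close> already lies in \<open>range F\<close>, and
  \<open>u\<close> can be taken in the initial space of \<open>E\<close> orthogonal to that of \<open>F\<close>.\<close>

lemma rank_one_out_of_initial_space:
  assumes pi: "\<forall>E\<in>\<F>. partial_isometry E"
    and tot: "\<forall>E\<in>\<F>. \<forall>F\<in>\<F>. hm_le E F \<or> hm_le F E"
    and E: "E \<in> \<F>" and nsub: "\<not> range E \<subseteq> initial_space E"
  obtains u y where "u \<in> initial_space E" "u \<noteq> 0" "y \<notin> initial_space E"
    "rank_one u y \<in> fam_ops \<F>"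
proof -
  have piE: "partial_isometry E" and bE: "E \<in> bounded_ops"
    using pi E partial_isometry_bounded_ops by blast+
  obtain x where x: "E x \<notin> initial_space E"
    using nsub by blast
  \<comment> \<open>\<open>v\<close> detects that a vector lies outside the initial space of \<open>E\<close>\<close>
  obtain v p where vp: "E x = v + p" "v \<in> kernel E" "p \<in> initial_space E"
    using kernel_initial_decomp[OF bE] by blast
  have "v \<noteq> 0"
    using x vp by auto
  have "cinner (E x) v = cinner v v"
    using cinner_initial_kernel[OF vp(3,2)] vp(1) by (simp add: cinner_add_left)
  then have w: "cinner x (adj E v) \<noteq> 0"
    using \<open>v \<noteq> 0\<close> cinner_adj[OF bE, of x v] by simp
  show thesis
  proof (cases "\<forall>F\<in>\<F>. \<not> hm_le E F \<longrightarrow> adj E v \<in> kernel F")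
    case True
    have "adj E v \<in> kernel F \<or> E x \<in> range F" if "F \<in> \<F>" for F
      using True that hm_le_range_mono[OF piE] by blast
    then have "rank_one (adj E v) (E x) \<in> fam_ops \<F>"
      by (rule rank_one_in_fam_ops[OF pi])
    moreover have "adj E v \<noteq> 0"
      using w by auto
    ultimately show thesis
      using that adj_in_initial_space[OF bE] x by blast
  next
    case False
    then obtain F where F: "F \<in> \<F>" "\<not> hm_le E F" "adj E v \<notin> kernel F"
      by blast
    then have piF: "partial_isometry F" and FE: "hm_le F E"
      using pi tot E by blast+
    obtain k q where kq: "adj E v = k + q" "k \<in> kernel F" "q \<in> initial_space F"
      using kernel_initial_decomp[OF partial_isometry_bounded_ops[OF piF]] by blast
    have "q \<noteq> 0"
      using F(3) kq by auto
    have "cinner (E q) v = cinner q q"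
      using kq cinner_initial_kernel[OF kq(3,2)]
      by (simp add: cinner_adj[OF bE] cinner_add_right)
    then have out: "E q \<notin> initial_space E"
      using \<open>q \<noteq> 0\<close> vp(2) cinner_initial_kernel by fastforce
    have Eq: "E q \<in> range F"
      using FE kq(3) by (metis hm_le_def rangeI)
    obtain u where u: "u \<in> initial_space E" "u \<in> kernel F" "u \<noteq> 0"
      using hm_less_orthogonal_vector[OF piF piE FE F(2)] by blast
    have "u \<in> kernel G \<or> E q \<in> range G" if G: "G \<in> \<F>" for G
    proof (cases "hm_le F G")
      case True
      then show ?thesis
        using Eq hm_le_range_mono[OF piF] by blast
    next
      case False
      then have "hm_le G F"
        using tot G F(1) by blast
      then show ?thesis
        using u(2) hm_le_kernel_antimono[OF _ piF] pi G by blast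
    qed
    then have "rank_one u (E q) \<in> fam_ops \<F>"
      by (rule rank_one_in_fam_ops[OF pi])
    then show thesis
      using that u out by blast
  qed
qed

text \<open>This is the dual step, looking upwards from \<open>E\<close>. If the final spaces strictly above \<open>E\<close>
  share a vector \<open>z\<close> outside \<open>range E\<close>, then \<open>v\<close> only has to be orthogonal to the initial space of
  \<open>E\<close>. Otherwise they intersect in \<open>range E\<close>; as all members above \<open>E\<close> agree on the
  intersection of their initial spaces, that intersection is the initial space of \<open>E\<close>, so
  some \<open>F\<close> strictly above \<open>E\<close> has \<open>y\<close> outside its initial space. Then \<open>v\<close> can be taken orthogonal
  to the initial space of \<open>F\<close>, and \<open>z\<close> in \<open>range F\<close>.\<close>

lemma rank_one_out_of_range:
  assumes pi: "\<forall>E\<in>\<F>. partial_isometry E"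
    and tot: "\<forall>E\<in>\<F>. \<forall>F\<in>\<F>. hm_le E F \<or> hm_le F E"
    and E: "E \<in> \<F>" and nonsurj: "range E \<noteq> UNIV" and y: "y \<notin> initial_space E"
  obtains v z where "cinner y v \<noteq> 0" "z \<notin> range E" "rank_one v z \<in> fam_ops \<F>"
proof -
  have piE: "partial_isometry E"
    using pi E by blast
  have kernel_part: "\<exists>v\<in>kernel F. cinner y v \<noteq> 0"
    if F: "F \<in> \<F>" and yF: "y \<notin> initial_space F" for F
  proof -
    obtain v p where vp: "y = v + p" "v \<in> kernel F" "p \<in> initial_space F"
      using kernel_initial_decomp pi F partial_isometry_bounded_ops by blast
    then have "cinner y v = cinner v v" "v \<noteq> 0"
      using cinner_initial_kernel[OF vp(3,2)] yF by (auto simp: cinner_add_left)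
    then show ?thesis
      using vp(2) cinner_self_eq_zero[of v] by metis
  qed
  have mem: "rank_one v z \<in> fam_ops \<F>"
    if F: "F \<in> \<F>" and v: "v \<in> kernel F" and z: "\<And>G. G \<in> \<F> \<Longrightarrow> \<not> hm_le G F \<Longrightarrow> z \<in> range G"
    for F v z
  proof (rule rank_one_in_fam_ops[OF pi])
    fix G
    assume "G \<in> \<F>"
    then show "v \<in> kernel G \<or> z \<in> range G"
      using hm_le_kernel_antimono[of G F] pi F v z by blast
  qed
  show thesis
  proof (cases "\<exists>z. z \<notin> range E \<and> (\<forall>G\<in>\<F>. \<not> hm_le G E \<longrightarrow> z \<in> range G)")
    case True
    then show thesis
      using kernel_part[OF E y] mem[OF E] that by blast
  next
    case False
    \<comment> \<open>without a member strictly above \<open>E\<close>, any vector outside \<open>range E\<close> would be such a \<open>z\<close>\<close>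
    then obtain F\<^sub>1 where F\<^sub>1: "F\<^sub>1 \<in> \<F>" "\<not> hm_le F\<^sub>1 E"
      using nonsurj by blast
    have "\<exists>F\<in>\<F>. \<not> hm_le F E \<and> y \<notin> initial_space F"
    proof (rule ccontr)
      assume "\<not> ?thesis"
      then have all: "y \<in> initial_space G" if "G \<in> \<F>" "\<not> hm_le G E" for G
        using that by blast
      have "F\<^sub>1 y \<in> range G" if G: "G \<in> \<F>" "\<not> hm_le G E" for G
      proof -
        have "F\<^sub>1 y = G y"
          using tot G(1) F\<^sub>1 all[OF G] all[OF F\<^sub>1] unfolding hm_le_def by metis
        then show ?thesis
          by simp
      qed
      then have "F\<^sub>1 y \<in> range E"
        using False by blast
      then show False
        using hm_le_preimage_in_initial_space[OF piE, of F\<^sub>1 y] pi tot E F\<^sub>1 all y by blast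
    qed
    then obtain F where F: "F \<in> \<F>" "\<not> hm_le F E" "y \<notin> initial_space F"
      by blast
    then have piF: "partial_isometry F" and "hm_le E F"
      using pi tot E by blast+
    then obtain z where z: "z \<in> range F" "z \<notin> range E"
      using hm_less_range[OF piE] F(2) by blast
    obtain v where v: "v \<in> kernel F" "cinner y v \<noteq> 0"
      using kernel_part F by blast
    have "z \<in> range G" if "G \<in> \<F>" "\<not> hm_le G F" for G
      using that tot F(1) z(1) hm_le_range_mono[OF piF] by blast
    then show thesis
      using that v z(2) mem[OF F(1) v(1)] by blast
  qed
qed

section \<open>The equivalence\<close>

lemma range_condition_if_op_algebra:
  assumes pi: "\<forall>E\<in>\<F>. partial_isometry E"
    and tot: "\<forall>E\<in>\<F>. \<forall>F\<in>\<F>. hm_le E F \<or> hm_le F E"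
    and alg: "op_algebra (fam_ops \<F>)" and E: "E \<in> \<F>"
  shows "range E \<subseteq> initial_space E \<or> range E = UNIV"
proof (rule ccontr)
  assume neg: "\<not> ?thesis"
  obtain u y where u: "u \<in> initial_space E" "u \<noteq> 0" and y: "y \<notin> initial_space E"
    and T: "rank_one u y \<in> fam_ops \<F>"
    using rank_one_out_of_initial_space[OF pi tot E] neg by blast
  obtain v z where v: "cinner y v \<noteq> 0" and z: "z \<notin> range E"
    and S: "rank_one v z \<in> fam_ops \<F>"
    using rank_one_out_of_range[OF pi tot E _ y] neg by blast
  define c where "c = cinner u u * cinner y v"
  have "c \<noteq> 0"
    using u(2) v by (simp add: c_def)
  have "rank_one v z \<circ> rank_one u y \<in> fam_ops \<F>"
    using alg S T by (simp add: op_algebra_def)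
  then have "(rank_one v z \<circ> rank_one u y) u \<in> range E"
    using u(1) E by (auto simp: mem_fam_ops_iff[OF pi] image_subset_iff)
  then have "c *\<^sub>C z \<in> range E"
    by (simp add: rank_one_def cinner_scaleC_left c_def)
  then have "inverse c *\<^sub>C c *\<^sub>C z \<in> range E"
    using pi E partial_isometry_bounded_ops range_bounded_op_subspace(3) by blast
  moreover have "inverse c *\<^sub>C c *\<^sub>C z = z"
    using \<open>c \<noteq> 0\<close> scaleC_of_real[of 1 z] by (simp add: scaleC_scaleC)
  ultimately show False
    using z by simp
qed

lemma left_ideal_if_range_condition:
  assumes pi: "\<forall>E\<in>\<F>. partial_isometry E"
    and cond: "\<forall>E\<in>\<F>. range E \<subseteq> initial_space E \<or> range E = UNIV"
  shows "left_ideal_of (fam_ops \<F>) (nest_algebra (final_nest \<F>))"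
proof -
  have "T \<in> nest_algebra (final_nest \<F>)" if T: "T \<in> fam_ops \<F>" for T
  proof -
    have "T ` range E \<subseteq> range E" if "E \<in> \<F>" for E
    proof (cases "range E = UNIV")
      case False
      then have "T ` range E \<subseteq> T ` initial_space E"
        using cond that by (intro image_mono) blast
      also have "\<dots> \<subseteq> range E"
        using T that by (simp add: mem_fam_ops_iff[OF pi])
      finally show ?thesis .
    qed simp
    then show ?thesis
      using T by (simp add: mem_fam_ops_iff[OF pi] mem_nest_algebra_final_nest_iff[OF pi])
  qed
  moreover have "S \<circ> T \<in> fam_ops \<F>"
    if S: "S \<in> nest_algebra (final_nest \<F>)" and T: "T \<in> fam_ops \<F>" for S T
  proof -
    have "(S \<circ> T) ` initial_space E \<subseteq> range E" if "E \<in> \<F>" for E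
    proof -
      have "(S \<circ> T) ` initial_space E \<subseteq> S ` range E"
        unfolding image_comp[symmetric]
        using T that by (intro image_mono) (simp add: mem_fam_ops_iff[OF pi])
      also have "\<dots> \<subseteq> range E"
        using S that by (simp add: mem_nest_algebra_final_nest_iff[OF pi])
      finally show ?thesis .
    qed
    then show ?thesis
      using S T bounded_ops_compose[of S T]
      unfolding mem_fam_ops_iff[OF pi] mem_nest_algebra_final_nest_iff[OF pi] by blast
  qed
  ultimately show ?thesis
    using op_subspace_fam_ops[OF pi] by (simp add: left_ideal_of_def subset_iff)
qed

lemma op_algebra_if_left_ideal: "left_ideal_of \<J> \<A> \<Longrightarrow> op_algebra \<J>"
  by (auto simp: left_ideal_of_def op_algebra_def)

theorem theorem2p2:
  fixes \<F> :: "('a::complex_hilbert_space \<Rightarrow> 'a) set"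
  assumes "\<forall>E\<in>\<F>. partial_isometry E"
    and "\<forall>E\<in>\<F>. \<forall>F\<in>\<F>. hm_le E F \<or> hm_le F E"
  shows "(op_algebra (fam_ops \<F>) \<longleftrightarrow>
            left_ideal_of (fam_ops \<F>) (nest_algebra (final_nest \<F>))) \<and>
         (left_ideal_of (fam_ops \<F>) (nest_algebra (final_nest \<F>)) \<longleftrightarrow>
            (\<forall>E\<in>\<F>. range E \<subseteq> orth_compl (kernel E) \<or> range E = UNIV))"
  using range_condition_if_op_algebra[OF assms] left_ideal_if_range_condition[OF assms(1)]
    op_algebra_if_left_ideal[of "fam_ops \<F>" "nest_algebra (final_nest \<F>)"]
  unfolding initial_space_def by blast

end
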